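(* Let $Q$ be a polytope in $\mathbb{R}^n$ and let $P$ be a lattice polytope (in $\mathbb{R}^n$) with vertex set $V(P)=\{v_1,\ldots,v_r\}$. Then the sequence $\{\sigma_{kP+Q}(\mathbf{x})\}_{k\geq 0}$ satisfies the linear recursion $$\sigma_{(k+r)P+Q}(\mathbf{x})=\sum_{\emptyset\neq I\subseteq[r]}(-1)^{1+|I|}\,\mathbf{x}^{\sum_{i\in I}v_i}\,\sigma_{(k+r-|I|)P+Q}(\mathbf{x})$$ (for all $k\geq 0$) with characteristic polynomial $$\chi_{P;Q}(X):=\prod_{\mathbf{v}\in V(P)}(X-\mathbf{x}^{\mathbf{v}}).$$ If $Q$ is a lattice polytope, then $\chi_{P;Q}$ is minimal.
   Context: A polytope is the convex hull of finitely many points in $\mathbb{R}^n$; it is a lattice polytope if all its vertices lie in the integer lattice $\mathbb{Z}^n$. $V(P)$ denotes the set of vertices of $P$, so $r$ is the number of vertices of $P$, and $[r]=\{1,\ldots,r\}$. For $\mathbf{m}\in\mathbb{Z}^n$, $\mathbf{x}^{\mathbf{m}}=x_1^{m_1}\cdots x_n^{m_n}$. The integer point transform of a polytope $P\subset\mathbb{R}^n$ is $\sigma_P(\mathbf{x})=\sum_{\mathbf{m}\in P\cap\mathbb{Z}^n}\mathbf{x}^{\mathbf{m}}\in\mathbb{C}[x_1^{\pm1},\ldots,x_n^{\pm1}]$. For an integer $k\ge 0$, $kP=\{kp: p\in P\}$ is the $k$-th dilate, and $P+Q=\{p+q: p\in P,\ q\in Q\}$ is the Minkowski sum. A sequence $\mathbf{a}=\{a_k\}_{k\geq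 0}$ of elements of $\mathbb{C}(x_1,\ldots,x_n)$ satisfies a linear recursion of order $d\geq 1$ if there are $c_1,\ldots,c_d\in\mathbb{C}(x_1,\ldots,x_n)$, $c_d\neq 0$, such that $a_k=\sum_{j=1}^d c_j a_{k-j}$ for all $k\geq d$. The corresponding characteristic polynomial is $\chi_{\mathbf{c}}=X^d-\sum_{j=1}^d c_jX^{d-j}\in\mathbb{C}(x_1,\ldots,x_n)[X]$. It is called minimal if $\chi_{\mathbf{c}}\mid\chi_{\mathbf{c}'}$ for every vector $\mathbf{c}'=(c'_1,\ldots,c'_{d'})$ corresponding to a linear recursion of $\mathbf{a}$. *)

theory Defs
  imports
    "HOL-Analysis.Analysis"
    "HOL-Library.Poly_Mapping"
    "HOL-Computational_Algebra.Polynomial"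
    "HOL-Computational_Algebra.Fraction_Field"
begin

section \<open>The field of rational functions\<close>

text \<open>
  The coordinates of \<open>real ^ 'n\<close> are indexed by an arbitrary finite type. The library shows that
  polynomials (finitely supported functions on monomials) form an integral domain only when the
  index type of the variables is linearly ordered. The copy \<open>'n var\<close> of the index type carries an
  arbitrary linear order, so that no such order has to be assumed on \<open>'n\<close> itself; the order does
  not enter any of the definitions below.
\<close>

datatype 'n var = Var (var_index: 'n)

instantiation var :: (countable) linorder
begin

definition less_eq_var :: "'a var \<Rightarrow> 'a var \<Rightarrow> bool" where
  "less_eq_var x y \<longleftrightarrow> to_nat (var_index x) \<le> to_nat (var_index y)"

definition less_var :: "'a var \<Rightarrow> 'a var \<Rightarrow> bool" where
  "less_var x y \<longleftrightarrow> to_nat (var_index x) < to_nat (var_index y)"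

instance
  by standard (auto simp: less_eq_var_def less_var_def intro: var.expand)

end

text \<open>\<open>\<complex>[x\<^sub>1,\<dots>,x\<^sub>n]\<close> and its fraction field \<open>\<complex>(x\<^sub>1,\<dots>,x\<^sub>n)\<close>.\<close>

type_synonym 'n mpoly = "('n var \<Rightarrow>\<^sub>0 nat) \<Rightarrow>\<^sub>0 complex"
type_synonym 'n ratfun = "'n mpoly fract"

definition indet :: "'n::finite \<Rightarrow> 'n ratfun" where
  "indet i = Fract (Poly_Mapping.single (Poly_Mapping.single (Var i) 1) 1) 1"

definition xpow :: "int ^ 'n \<Rightarrow> 'n::finite ratfun" where
  "xpow m = (\<Prod>i\<in>UNIV. indet i powi (m $ i))"

section \<open>Polytopes and integer point transforms\<close>

definition real_vec :: "int ^ 'n \<Rightarrow> real ^ 'n" where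
  "real_vec m = (\<chi> i. real_of_int (m $ i))"

definition vertices :: "(real ^ 'n) set \<Rightarrow> (real ^ 'n) set" where
  "vertices P = {v. v extreme_point_of P}"

definition lattice_polytope :: "(real ^ 'n) set \<Rightarrow> bool" where
  "lattice_polytope P \<longleftrightarrow> polytope P \<and> vertices P \<subseteq> range real_vec"

definition dilate :: "nat \<Rightarrow> (real ^ 'n) set \<Rightarrow> (real ^ 'n) set" where
  "dilate k P = (\<lambda>p. real k *\<^sub>R p) ` P"

text \<open>
  The Laurent polynomial is taken as an element of the field of rational functions. The index set
  is finite whenever \<open>P\<close> is bounded, in particular for polytopes.
\<close>

definition int_transform :: "(real ^ 'n) set \<Rightarrow> 'n::finite ratfun" where
  "int_transform P = (\<Sum>m | real_vec m \<in> P. xpow m)"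

section \<open>Linear recursions\<close>

text \<open>Only the values \<open>c 1, \<dots>, c d\<close> are relevant in the following definitions.\<close>

definition linear_recursion :: "(nat \<Rightarrow> 'a::field) \<Rightarrow> nat \<Rightarrow> (nat \<Rightarrow> 'a) \<Rightarrow> bool" where
  "linear_recursion a d c \<longleftrightarrow>
     d \<ge> 1 \<and> c d \<noteq> 0 \<and> (\<forall>k\<ge>d. a k = (\<Sum>j = 1..d. c j * a (k - j)))"

definition recursion_poly :: "nat \<Rightarrow> (nat \<Rightarrow> 'a::field) \<Rightarrow> 'a poly" where
  "recursion_poly d c = monom 1 d - (\<Sum>j = 1..d. monom (c j) (d - j))"

definition minimal_for :: "(nat \<Rightarrow> 'a::field) \<Rightarrow> 'a poly \<Rightarrow> bool" where
  "minimal_for a p \<longleftrightarrow> (\<exists>d c. linear_recursion a d c \<and> p = recursion_poly d c) \<and>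
     (\<forall>d c. linear_recursion a d c \<longrightarrow> p dvd recursion_poly d c)"

text \<open>
  The coefficient of the term of index \<open>k + r - j\<close> in the recursion for \<open>kP + Q\<close>, obtained by
  collecting the index sets \<open>I\<close> of size \<open>j\<close>.
\<close>

definition vertex_coeff :: "nat \<Rightarrow> (nat \<Rightarrow> int ^ 'n) \<Rightarrow> nat \<Rightarrow> 'n::finite ratfun" where
  "vertex_coeff r v j =
     (\<Sum>I | I \<subseteq> {1..r} \<and> card I = j. (-1) ^ (1 + card I) * xpow (\<Sum>i\<in>I. v i))"

text \<open>
  The product ranges over the integer vertices of \<open>P\<close>, which are all vertices for a lattice polytope.
\<close>

definition vertex_poly :: "(real ^ 'n) set \<Rightarrow> 'n::finite ratfun poly" where
  "vertex_poly P = (\<Prod>v | real_vec v \<in> vertices P. [:- xpow v, 1:])"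

end

theory Submission
  imports Defs
begin

text \<open>
  Applied to the sequence \<open>\<sigma>(kP + Q)\<close>, a product of shift operators \<open>X - x^v\<^sub>i\<close>, \<open>i \<in> J\<close>, yields a Laurent
  polynomial whose coefficient at \<open>x^m\<close> is the sum of \<open>(-1)^|I|\<close> over those \<open>I \<subseteq> J\<close> with
  \<open>m - v\<^sub>I \<in> (k + |J| - |I|)P + Q\<close>, where \<open>v\<^sub>I\<close> is the sum of the \<open>v\<^sub>i\<close>, \<open>i \<in> I\<close>. If \<open>J\<close> indexes all vertices, this
  condition says that the compact convex set of all \<open>\<mu> \<ge> 0\<close> with \<open>\<Sum>\<mu>\<^sub>i = k + r\<close> and
  \<open>m - \<Sum>\<mu>\<^sub>i v\<^sub>i \<in> Q\<close> meets \<open>{\<mu>. \<mu>\<^sub>i \<ge> 1 for i \<in> I}\<close>. Since \<open>\<Sum>\<mu>\<^sub>i \<ge> r\<close> forces some \<open>\<mu>\<^sub>i \<ge> 1\<close>, the alternating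
  sum of the indicator functions of these sets is zero, and so is the alternating sum of their Euler
  characteristics, which are 1 for the nonempty sets and 0 for the empty one. This is the recursion.

  For minimality, it suffices that omitting a single factor \<open>X - x^v\<^sub>i\<close> gives a nonzero value: then the
  sequence has a nonzero component along each of the distinct roots \<open>x^v\<^sub>i\<close>. Let \<open>c\<close> be a functional
  with unique maximum \<open>v\<^sub>i\<close> on \<open>P\<close> and \<open>w\<close> a vertex of \<open>Q\<close> maximizing \<open>c\<close>. At \<open>m = (r - 1)v\<^sub>i + w\<close> only
  \<open>I = {}\<close> contributes to the coefficient.
\<close>

section \<open>The Euler characteristic of compact convex sets\<close>

text \<open>The one-dimensional case: a relation between indicator functions of closed intervals
  localizes at right endpoints, and each interval has exactly one.\<close>

lemma interval_relation_sum:
  fixes \<alpha> \<beta> :: "'j \<Rightarrow> real" and a :: "'j \<Rightarrow> 'b::ab_group_add"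
  assumes "finite J" and le: "\<And>j. j \<in> J \<Longrightarrow> \<alpha> j \<le> \<beta> j"
    and rel: "\<And>t. (\<Sum>j | j \<in> J \<and> \<alpha> j \<le> t \<and> t \<le> \<beta> j. a j) = 0"
  shows "(\<Sum>j\<in>J. a j) = 0"
proof -
  \<comment> \<open>The value at \<open>t\<close> minus the limit from the right only sees the intervals that end at \<open>t\<close>.\<close>
  have right_end: "(\<Sum>j | j \<in> J \<and> \<beta> j = t. a j) = 0" for t
  proof -
    \<comment> \<open>\<open>s\<close> is chosen between \<open>t\<close> and the next endpoint, so
      an interval contains \<open>s\<close> iff it contains \<open>t\<close> and does not end
      there.\<close>
    define E where "E = {e \<in> \<alpha> ` J \<union> \<beta> ` J. t < e}"
    have "finite E" using assms(1) by (simp add: E_def)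
    obtain s where s: "t < s" "\<And>e. e \<in> E \<Longrightarrow> s < e"
    proof (cases "E = {}")
      case True
      then show ?thesis using that[of "t + 1"] by simp
    next
      case False
      then have "t < Min E" using \<open>finite E\<close> by (auto simp: E_def)
      then obtain s where "t < s" "s < Min E" using dense by blast
      then show ?thesis using that[of s] \<open>finite E\<close> False by auto
    qed
    have s': "\<alpha> j \<le> s \<longleftrightarrow> \<alpha> j \<le> t" "s \<le> \<beta> j \<longleftrightarrow> t < \<beta> j" if "j \<in> J" for j
      using s that by (force simp: E_def not_le)+
    have "{j. j \<in> J \<and> \<alpha> j \<le> t \<and> t \<le> \<beta> j} =
        {j. j \<in> J \<and> \<alpha> j \<le> s \<and> s \<le> \<beta> j} \<union> {j. j \<in> J \<and> \<beta> j = t}"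
      using s' le by fastforce
    moreover have "{j. j \<in> J \<and> \<alpha> j \<le> s \<and> s \<le> \<beta> j} \<inter> {j. j \<in> J \<and> \<beta> j = t} = {}"
      using s' by auto
    ultimately have "(\<Sum>j | j \<in> J \<and> \<alpha> j \<le> t \<and> t \<le> \<beta> j. a j) =
        (\<Sum>j | j \<in> J \<and> \<alpha> j \<le> s \<and> s \<le> \<beta> j. a j) + (\<Sum>j | j \<in> J \<and> \<beta> j = t. a j)"
      using assms(1) by (simp add: sum.union_disjoint)
    then show ?thesis using rel by simp
  qed
  have "(\<Sum>j\<in>J. a j) = (\<Sum>t\<in>\<beta> ` J. \<Sum>j | j \<in> J \<and> \<beta> j = t. a j)"
    using assms(1) by (intro sum.group[symmetric]) auto
  then show ?thesis using right_end by simp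
qed

text \<open>
  The sum that vanishes by this lemma is the Euler characteristic of the linear combination of
  indicator functions. The ambient space is a function space because the dimension depends on the
  number of vertices, which is not a type.
\<close>

lemma compact_convex_relation_sum:
  fixes K :: "'j \<Rightarrow> ('i \<Rightarrow> real) set" and a :: "'j \<Rightarrow> 'b::ab_group_add"
  assumes "finite B" "finite J"
    and "\<And>j. j \<in> J \<Longrightarrow> compact (K j)"
    and "\<And>j x y u. \<lbrakk>j \<in> J; x \<in> K j; y \<in> K j; 0 \<le> u; u \<le> 1\<rbrakk>
           \<Longrightarrow> (\<lambda>i. (1 - u) * x i + u * y i) \<in> K j"
    and "\<And>j x i. \<lbrakk>j \<in> J; x \<in> K j; i \<notin> B\<rbrakk> \<Longrightarrow> x i = c i"
    and "\<And>x. (\<Sum>j | j \<in> J \<and> x \<in> K j. a j) = 0"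
  shows "(\<Sum>j | j \<in> J \<and> K j \<noteq> {}. a j) = 0"
  using assms(1,3-)
proof (induction B arbitrary: K c rule: finite_induct)
  \<comment> \<open>Every point of every \<open>K j\<close> equals \<open>c\<close>, so the relation
    at \<open>c\<close> is the claim.\<close>
  case empty
  then have "x = c" if "j \<in> J" "x \<in> K j" for j x
    using that by auto
  then have "{j. j \<in> J \<and> K j \<noteq> {}} = {j. j \<in> J \<and> c \<in> K j}" by blast
  then show ?case using empty by simp
next
  case (insert b B)
  \<comment> \<open>For nonempty \<open>K j\<close>, compactness and convexity make the projection
    to coordinate \<open>b\<close> the closed interval with these ends.\<close>
  define \<alpha> where "\<alpha> j = Inf ((\<lambda>x. x b) ` K j)" for j
  define \<beta> where "\<beta> j = Sup ((\<lambda>x. x b) ` K j)" for j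
  have cont: "continuous_on S (\<lambda>x. x b)" for S :: "('i \<Rightarrow> real) set"
    by (rule continuous_on_subset[OF continuous_on_product_coordinates subset_UNIV])
  have slice: "K j \<inter> {x. x b = t} \<noteq> {} \<longleftrightarrow> \<alpha> j \<le> t \<and> t \<le> \<beta> j"
    if j: "j \<in> J" and ne: "K j \<noteq> {}" for j t
  proof -
    let ?T = "(\<lambda>x. x b) ` K j"
    have comp: "compact ?T"
      using insert.prems(1)[OF j] cont by (rule compact_continuous_image[rotated])
    have bdd: "bdd_below ?T" "bdd_above ?T"
      using comp by (auto intro!: bounded_imp_bdd_below bounded_imp_bdd_above compact_imp_bounded)
    have ends: "\<alpha> j \<in> ?T" "\<beta> j \<in> ?T"
      using closed_contains_Inf[of ?T] closed_contains_Sup[of ?T] ne comp bdd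
      by (auto simp: \<alpha>_def \<beta>_def compact_imp_closed)
    have "convex ?T"
    proof (rule convexI)
      fix p q u v :: real
      assume "p \<in> ?T" "q \<in> ?T" and u: "0 \<le> u" "0 \<le> v" "u + v = 1"
      then obtain x y where xy: "x \<in> K j" "y \<in> K j" "p = x b" "q = y b" by auto
      have "(\<lambda>i. (1 - v) * x i + v * y i) \<in> K j"
        using u by (intro insert.prems(2) j xy) auto
      moreover have "u *\<^sub>R p + v *\<^sub>R q = (1 - v) * x b + v * y b"
        using xy u by (simp add: eq_diff_eq)
      ultimately show "u *\<^sub>R p + v *\<^sub>R q \<in> ?T" by (auto intro!: image_eqI)
    qed
    then have "is_interval ?T" by (simp add: is_interval_convex_1)
    then have "t \<in> ?T" if "\<alpha> j \<le> t" "t \<le> \<beta> j"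
      using ends that unfolding is_interval_1 by blast
    moreover have "\<alpha> j \<le> t \<and> t \<le> \<beta> j" if "t \<in> ?T"
      using that bdd by (auto simp: \<alpha>_def \<beta>_def intro: cInf_lower cSup_upper)
    ultimately show ?thesis by blast
  qed
  \<comment> \<open>The slices satisfy the same relation with coordinate \<open>b\<close> frozen at
    \<open>t\<close>, hence the updated \<open>c\<close>.\<close>
  have zero: "(\<Sum>j | j \<in> J \<and> K j \<inter> {x. x b = t} \<noteq> {}. a j) = 0" for t
  proof (rule insert.IH[of _ "c(b := t)"])
    show "compact (K j \<inter> {x. x b = t})" if "j \<in> J" for j
    proof (rule compact_Int_closed)
      have "closed ((\<lambda>x::'i \<Rightarrow> real. x b) -` {t})"
        by (rule closed_vimage) (use cont in auto)
      then show "closed {x::'i \<Rightarrow> real. x b = t}" by (simp add: vimage_def)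
    qed (use insert.prems that in auto)
    show "(\<lambda>i. (1 - u) * x i + u * y i) \<in> K j \<inter> {x. x b = t}"
      if "j \<in> J" "x \<in> K j \<inter> {x. x b = t}" "y \<in> K j \<inter> {x. x b = t}" "0 \<le> u" "u \<le> 1"
      for j x y u
      using insert.prems(2)[of j x y u] that by (auto simp: algebra_simps)
    show "x i = (c(b := t)) i" if "j \<in> J" "x \<in> K j \<inter> {x. x b = t}" "i \<notin> B" for j x i
      using insert.prems(3)[of j x i] that by auto
    show "(\<Sum>j | j \<in> J \<and> x \<in> K j \<inter> {x. x b = t}. a j) = 0" for x
      using insert.prems(4)[of x] by (cases "x b = t") auto
  qed
  \<comment> \<open>The slice sums form a relation between the projected intervals. Empty
    \<open>K j\<close> are discarded first, as their \<open>\<alpha>\<close> and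
    \<open>\<beta>\<close> are meaningless.\<close>
  show ?case
  proof (rule interval_relation_sum)
    show "finite {j. j \<in> J \<and> K j \<noteq> {}}" using assms(2) by simp
    show "\<alpha> j \<le> \<beta> j" if j: "j \<in> {j. j \<in> J \<and> K j \<noteq> {}}" for j
    proof -
      obtain x where "x \<in> K j" using j by blast
      then show ?thesis using slice[of j "x b"] j by auto
    qed
    show "(\<Sum>j | j \<in> {j. j \<in> J \<and> K j \<noteq> {}} \<and> \<alpha> j \<le> t \<and> t \<le> \<beta> j. a j) = 0" for t
    proof -
      have "{j. j \<in> {j. j \<in> J \<and> K j \<noteq> {}} \<and> \<alpha> j \<le> t \<and> t \<le> \<beta> j} =
          {j. j \<in> J \<and> K j \<inter> {x. x b = t} \<noteq> {}}"
        using slice by blast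
      then show ?thesis using zero by simp
    qed
  qed
qed

section \<open>Alternating sums of dilates\<close>

text \<open>Barycentric coordinates, scaled to total weight \<open>s\<close>. Injectivity of
  \<open>V\<close> lets the weights sit on indices instead of points.\<close>

lemma dilate_plus_iff:
  fixes V :: "'i \<Rightarrow> real ^ 'n"
  assumes "finite A" "A \<noteq> {}" "inj_on V A"
  shows "x \<in> dilate s (convex hull (V ` A)) + Q \<longleftrightarrow>
    (\<exists>\<mu>. (\<forall>i\<in>A. 0 \<le> \<mu> i) \<and> sum \<mu> A = real s \<and> x - (\<Sum>i\<in>A. \<mu> i *\<^sub>R V i) \<in> Q)"
proof -
  have hull: "convex hull (V ` A) =
      {\<Sum>i\<in>A. w i *\<^sub>R V i | w. (\<forall>i\<in>A. 0 \<le> w i) \<and> sum w A = 1}" (is "_ = ?H")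
  proof
    show "convex hull (V ` A) \<subseteq> ?H"
    proof
      fix y assume "y \<in> convex hull (V ` A)"
      then obtain u where "\<forall>z\<in>V ` A. 0 \<le> u z" "sum u (V ` A) = 1" "(\<Sum>z\<in>V ` A. u z *\<^sub>R z) = y"
        using assms(1) by (auto simp: convex_hull_finite)
      then show "y \<in> ?H"
        by (auto simp: sum.reindex[OF assms(3)] intro!: exI[of _ "u \<circ> V"])
    qed
    show "?H \<subseteq> convex hull (V ` A)"
    proof clarify
      fix w :: "'i \<Rightarrow> real" assume "\<forall>i\<in>A. 0 \<le> w i" "sum w A = 1"
      then show "(\<Sum>i\<in>A. w i *\<^sub>R V i) \<in> convex hull (V ` A)"
        by (intro convex_sum assms(1) convex_convex_hull hull_inc imageI) auto
    qed
  qed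
  have dil: "dilate s (convex hull (V ` A)) =
      {\<Sum>i\<in>A. w i *\<^sub>R V i | w. (\<forall>i\<in>A. 0 \<le> w i) \<and> sum w A = real s}" (is "_ = ?D")
  proof
    show "dilate s (convex hull (V ` A)) \<subseteq> ?D"
    proof
      fix y assume "y \<in> dilate s (convex hull (V ` A))"
      then obtain w where "\<forall>i\<in>A. 0 \<le> w i" "sum w A = 1" "y = real s *\<^sub>R (\<Sum>i\<in>A. w i *\<^sub>R V i)"
        unfolding hull dilate_def by blast
      then show "y \<in> ?D"
        by (auto simp: scaleR_sum_right sum_distrib_left[symmetric]
            intro!: exI[of _ "\<lambda>i. real s * w i"])
    qed
    show "?D \<subseteq> dilate s (convex hull (V ` A))"
    proof clarify
      fix w assume w: "\<forall>i\<in>A. 0 \<le> w i" "sum w A = real s"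
      show "(\<Sum>i\<in>A. w i *\<^sub>R V i) \<in> dilate s (convex hull (V ` A))"
      \<comment> \<open>For \<open>s = 0\<close> division is impossible, but all weights vanish and,
        since \<open>A\<close> is nonempty, the dilate is the origin.\<close>
      proof (cases "s = 0")
        case True
        then have "\<forall>i\<in>A. w i = 0" using w assms(1) by (simp add: sum_nonneg_eq_0_iff)
        moreover have "convex hull (V ` A) \<noteq> {}" using assms(2) by simp
        ultimately show ?thesis using True by (auto simp: dilate_def image_constant_conv)
      next
        case False
        have "(\<Sum>i\<in>A. (w i / s) *\<^sub>R V i) \<in> convex hull (V ` A)"
          unfolding hull using w False
          by (auto simp: sum_divide_distrib[symmetric] intro!: exI[of _ "\<lambda>i. w i / s"])
        moreover have "(\<Sum>i\<in>A. w i *\<^sub>R V i) = real s *\<^sub>R (\<Sum>i\<in>A. (w i / s) *\<^sub>R V i)"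
          using False by (simp add: scaleR_sum_right)
        ultimately show ?thesis unfolding dilate_def by blast
      qed
    qed
  qed
  show ?thesis
  proof
    assume "x \<in> dilate s (convex hull (V ` A)) + Q"
    then show "\<exists>\<mu>. (\<forall>i\<in>A. 0 \<le> \<mu> i) \<and> sum \<mu> A = real s \<and> x - (\<Sum>i\<in>A. \<mu> i *\<^sub>R V i) \<in> Q"
      unfolding dil set_plus_def by force
  next
    assume "\<exists>\<mu>. (\<forall>i\<in>A. 0 \<le> \<mu> i) \<and> sum \<mu> A = real s \<and> x - (\<Sum>i\<in>A. \<mu> i *\<^sub>R V i) \<in> Q"
    then obtain \<mu> where \<mu>: "\<forall>i\<in>A. 0 \<le> \<mu> i" "sum \<mu> A = real s" "x - (\<Sum>i\<in>A. \<mu> i *\<^sub>R V i) \<in> Q"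
      by blast
    then have "(\<Sum>i\<in>A. \<mu> i *\<^sub>R V i) \<in> ?D" by blast
    then have "(\<Sum>i\<in>A. \<mu> i *\<^sub>R V i) + (x - (\<Sum>i\<in>A. \<mu> i *\<^sub>R V i)) \<in> ?D + Q"
      using \<mu>(3) by (rule set_plus_intro)
    then show "x \<in> dilate s (convex hull (V ` A)) + Q" unfolding dil by simp
  qed
qed

text \<open>Expansion of a product of \<open>card A\<close> factors \<open>-1 + 1\<close>.\<close>

lemma sum_subsets_alternating:
  assumes "finite A" "A \<noteq> {}"
  shows "(\<Sum>I\<in>Pow A. (-1) ^ card I) = (0 :: 'b::comm_ring_1)"
  using prod_add[OF assms(1), of "\<lambda>_. -1 :: 'b" "\<lambda>_. 1"] assms by (simp add: zero_power card_gt_0_iff)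

text \<open>The geometric core of the recursion: membership in the dilates is nonemptiness of
  compact convex weight sets \<open>K I\<close>, to which \<open>compact_convex_relation_sum\<close>
  applies.\<close>

lemma alternating_sum_dilates:
  fixes V :: "'i \<Rightarrow> real ^ 'n"
  assumes "finite A" "A \<noteq> {}" "inj_on V A" "compact Q" "convex Q"
  shows "(\<Sum>I | I \<subseteq> A \<and> x - (\<Sum>i\<in>I. V i) \<in> dilate (k + card A - card I) (convex hull (V ` A)) + Q.
            (-1) ^ card I) = (0 :: 'b::comm_ring_1)"
proof -
  define c where "c = real (k + card A)"
  \<comment> \<open>The upper bound \<open>c\<close> on single weights follows from their sum and
    gives a compact box. Coordinates outside \<open>A\<close> are pinned to 0, so only finitely many
    vary.\<close>
  define K where "K I = {\<mu>. \<forall>i. \<mu> i \<in> (if i \<in> A then {0..c} else {0})} \<inter> (\<Inter>i\<in>I. {\<mu>. 1 \<le> \<mu> i}) \<inter>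
      {\<mu>. sum \<mu> A = c} \<inter> {\<mu>. x - (\<Sum>i\<in>A. \<mu> i *\<^sub>R V i) \<in> Q}" for I
  have K_iff: "\<mu> \<in> K I \<longleftrightarrow> (\<forall>i\<in>A. 0 \<le> \<mu> i) \<and> (\<forall>i. i \<notin> A \<longrightarrow> \<mu> i = 0) \<and> (\<forall>i\<in>I. 1 \<le> \<mu> i) \<and>
      sum \<mu> A = c \<and> x - (\<Sum>i\<in>A. \<mu> i *\<^sub>R V i) \<in> Q" for \<mu> I
  proof -
    have "\<mu> i \<le> c" if "sum \<mu> A = c" "\<forall>i\<in>A. 0 \<le> \<mu> i" "i \<in> A" for i
      using that assms(1) member_le_sum[of i A \<mu>] by auto
    then show ?thesis unfolding K_def by auto
  qed
  have cont: "continuous_on UNIV (\<lambda>\<mu>::'i \<Rightarrow> real. \<mu> i)" for i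
    by (rule continuous_on_product_coordinates)
  have euler: "(\<Sum>I | I \<in> Pow A \<and> K I \<noteq> {}. (-1) ^ card I) = (0 :: 'b)"
  proof (rule compact_convex_relation_sum[where B = A and c = "\<lambda>_. 0"])
    fix I assume "I \<in> Pow A"
    have "{\<mu>::'i \<Rightarrow> real. \<forall>i. \<mu> i \<in> (if i \<in> A then {0..c} else {0})} =
        PiE UNIV (\<lambda>i. if i \<in> A then {0..c} else {0})"
      by (simp only: PiE_UNIV_domain Pi_def UNIV_I simp_thms)
    moreover have "compactin (product_topology (\<lambda>_. euclidean) UNIV)
        (PiE UNIV (\<lambda>i::'i. if i \<in> A then {0..c} else {0}))"
      by (rule iffD2[OF compactin_PiE disjI2]) auto
    ultimately have box: "compact {\<mu>::'i \<Rightarrow> real. \<forall>i. \<mu> i \<in> (if i \<in> A then {0..c} else {0})}"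
      by (simp add: euclidean_product_topology)
    have "closed {\<mu>::'i \<Rightarrow> real. 1 \<le> \<mu> i}" for i
      by (intro closed_Collect_le continuous_intros cont)
    moreover have "closed {\<mu>::'i \<Rightarrow> real. sum \<mu> A = c}"
      by (intro closed_Collect_eq continuous_intros cont)
    moreover have "closed ((\<lambda>\<mu>. x - (\<Sum>i\<in>A. \<mu> i *\<^sub>R V i)) -` Q)"
      by (intro closed_vimage compact_imp_closed assms continuous_intros cont)
    ultimately show "compact (K I)"
      unfolding K_def using box by (intro compact_Int_closed closed_INT) (auto simp: vimage_def)
  next
    fix I \<mu> \<nu> and u :: real
    assume "\<mu> \<in> K I" "\<nu> \<in> K I" and u: "0 \<le> u" "u \<le> 1"
    then have \<mu>: "\<forall>i\<in>A. 0 \<le> \<mu> i" "\<forall>i. i \<notin> A \<longrightarrow> \<mu> i = 0" "\<forall>i\<in>I. 1 \<le> \<mu> i"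
        "sum \<mu> A = c" "x - (\<Sum>i\<in>A. \<mu> i *\<^sub>R V i) \<in> Q"
      and \<nu>: "\<forall>i\<in>A. 0 \<le> \<nu> i" "\<forall>i. i \<notin> A \<longrightarrow> \<nu> i = 0" "\<forall>i\<in>I. 1 \<le> \<nu> i"
        "sum \<nu> A = c" "x - (\<Sum>i\<in>A. \<nu> i *\<^sub>R V i) \<in> Q"
      unfolding K_iff by auto
    show "(\<lambda>i. (1 - u) * \<mu> i + u * \<nu> i) \<in> K I"
      unfolding K_iff
    proof (intro conjI ballI allI impI)
      show "1 \<le> (1 - u) * \<mu> i + u * \<nu> i" if "i \<in> I" for i
      proof -
        have "(1 - u) * 1 + u * 1 \<le> (1 - u) * \<mu> i + u * \<nu> i"
          using \<mu>(3) \<nu>(3) u that by (intro add_mono mult_left_mono) auto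
        then show ?thesis by simp
      qed
      have "(\<Sum>i\<in>A. (1 - u) * \<mu> i + u * \<nu> i) = (1 - u) * sum \<mu> A + u * sum \<nu> A"
        by (simp only: sum.distrib sum_distrib_left)
      then show "(\<Sum>i\<in>A. (1 - u) * \<mu> i + u * \<nu> i) = c"
        using \<mu>(4) \<nu>(4) by (simp add: algebra_simps)
      have "(\<Sum>i\<in>A. ((1 - u) * \<mu> i + u * \<nu> i) *\<^sub>R V i) =
          (1 - u) *\<^sub>R (\<Sum>i\<in>A. \<mu> i *\<^sub>R V i) + u *\<^sub>R (\<Sum>i\<in>A. \<nu> i *\<^sub>R V i)"
        by (simp add: scaleR_add_left sum.distrib scaleR_sum_right)
      then have "x - (\<Sum>i\<in>A. ((1 - u) * \<mu> i + u * \<nu> i) *\<^sub>R V i) =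
          (1 - u) *\<^sub>R (x - (\<Sum>i\<in>A. \<mu> i *\<^sub>R V i)) + u *\<^sub>R (x - (\<Sum>i\<in>A. \<nu> i *\<^sub>R V i))"
        by (simp add: algebra_simps)
      also have "\<dots> \<in> Q" using \<mu>(5) \<nu>(5) u by (intro convexD assms) auto
      finally show "x - (\<Sum>i\<in>A. ((1 - u) * \<mu> i + u * \<nu> i) *\<^sub>R V i) \<in> Q" .
    qed (use \<mu> \<nu> u in auto)
  next
    fix \<mu> :: "'i \<Rightarrow> real"
    show "(\<Sum>I | I \<in> Pow A \<and> \<mu> \<in> K I. (-1) ^ card I) = (0 :: 'b)"
    proof (cases "\<mu> \<in> K {}")
      case True
      \<comment> \<open>For \<open>I \<subseteq> A\<close>, membership of \<open>\<mu>\<close> in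
        \<open>K I\<close> means \<open>I \<subseteq> B\<close>. Were \<open>B\<close> empty, the
        weights would sum to less than \<open>card A \<le> c\<close>.\<close>
      define B where "B = {i \<in> A. 1 \<le> \<mu> i}"
      have "B \<noteq> {}"
      proof
        assume "B = {}"
        then have "sum \<mu> A < (\<Sum>i\<in>A. 1)"
          using assms by (intro sum_strict_mono) (auto simp: B_def not_le)
        then show False using True by (simp add: K_iff c_def)
      qed
      moreover have "{I. I \<in> Pow A \<and> \<mu> \<in> K I} = Pow B"
        using True by (auto simp: K_iff B_def)
      ultimately show ?thesis
        using sum_subsets_alternating[of B] assms(1) by (simp add: B_def)
    next
      case False
      then have "{I. I \<in> Pow A \<and> \<mu> \<in> K I} = {}" by (auto simp: K_iff)
      then show ?thesis by (simp only: sum.empty)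
    qed
  qed (use assms in \<open>auto simp: K_iff\<close>)
  have nonempty_iff: "K I \<noteq> {} \<longleftrightarrow>
      x - (\<Sum>i\<in>I. V i) \<in> dilate (k + card A - card I) (convex hull (V ` A)) + Q" if "I \<subseteq> A" for I
  proof -
    \<comment> \<open>Subtracting or adding the indicator \<open>e\<close> of \<open>I\<close>
      passes between weights in \<open>K I\<close> and weights of total
      \<open>k + card A - card I\<close>.\<close>
    define e where "e i = (if i \<in> I then 1 else 0 :: real)" for i
    have IA: "card I \<le> card A" using that assms(1) by (auto intro: card_mono)
    have "sum e A = sum e I"
      using that assms(1) by (intro sum.mono_neutral_right) (auto simp: e_def)
    moreover have "(\<Sum>i\<in>A. e i *\<^sub>R V i) = (\<Sum>i\<in>I. e i *\<^sub>R V i)"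
      using that assms(1) by (intro sum.mono_neutral_right) (auto simp: e_def)
    ultimately have e_sum: "sum e A = card I" "(\<Sum>i\<in>A. e i *\<^sub>R V i) = (\<Sum>i\<in>I. V i)"
      by (simp_all add: e_def)
    show ?thesis unfolding dilate_plus_iff[OF assms(1-3)]
    proof
      assume "K I \<noteq> {}"
      then obtain \<mu> where \<mu>: "\<mu> \<in> K I" by blast
      have "\<forall>i\<in>A. 0 \<le> \<mu> i - e i" using \<mu> by (auto simp: K_iff e_def)
      moreover have "(\<Sum>i\<in>A. \<mu> i - e i) = real (k + card A - card I)"
        using \<mu> e_sum IA by (simp add: K_iff sum_subtractf c_def)
      moreover have "x - (\<Sum>i\<in>I. V i) - (\<Sum>i\<in>A. (\<mu> i - e i) *\<^sub>R V i) \<in> Q"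
        using \<mu> e_sum by (simp add: K_iff sum_subtractf scaleR_diff_left)
      ultimately show "\<exists>\<mu>. (\<forall>i\<in>A. 0 \<le> \<mu> i) \<and> sum \<mu> A = real (k + card A - card I) \<and>
          x - (\<Sum>i\<in>I. V i) - (\<Sum>i\<in>A. \<mu> i *\<^sub>R V i) \<in> Q"
        by (intro exI[of _ "\<lambda>i. \<mu> i - e i"]) simp
    next
      assume "\<exists>\<mu>. (\<forall>i\<in>A. 0 \<le> \<mu> i) \<and> sum \<mu> A = real (k + card A - card I) \<and>
          x - (\<Sum>i\<in>I. V i) - (\<Sum>i\<in>A. \<mu> i *\<^sub>R V i) \<in> Q"
      then obtain \<mu> where \<mu>: "\<forall>i\<in>A. 0 \<le> \<mu> i" "sum \<mu> A = real (k + card A - card I)"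
          "x - (\<Sum>i\<in>I. V i) - (\<Sum>i\<in>A. \<mu> i *\<^sub>R V i) \<in> Q" by blast
      define \<nu> where "\<nu> i = (if i \<in> A then \<mu> i + e i else 0)" for i
      have "sum \<nu> A = sum \<mu> A + sum e A"
        by (simp add: \<nu>_def sum.distrib)
      moreover have "(\<Sum>i\<in>A. \<nu> i *\<^sub>R V i) = (\<Sum>i\<in>A. \<mu> i *\<^sub>R V i) + (\<Sum>i\<in>A. e i *\<^sub>R V i)"
        by (simp add: \<nu>_def sum.distrib scaleR_add_left)
      ultimately have "\<nu> \<in> K I"
        using \<mu> e_sum IA that unfolding K_iff
        by (auto simp: c_def \<nu>_def e_def algebra_simps of_nat_diff)
      then show "K I \<noteq> {}" by blast
    qed
  qed
  have "{I. I \<in> Pow A \<and> K I \<noteq> {}} = {I. I \<subseteq> A \<and>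
      x - (\<Sum>i\<in>I. V i) \<in> dilate (k + card A - card I) (convex hull (V ` A)) + Q}"
    by (intro Collect_cong) (metis Pow_iff nonempty_iff)
  with euler show ?thesis by (simp only:)
qed

section \<open>Shift operators and linear recursions\<close>

text \<open>The module structure on sequences over the polynomial ring, the variable acting as the
  left shift.\<close>

definition shift_apply :: "'a::comm_ring_1 poly \<Rightarrow> (nat \<Rightarrow> 'a) \<Rightarrow> nat \<Rightarrow> 'a" where
  "shift_apply p a k = (\<Sum>l\<le>degree p. coeff p l * a (k + l))"

lemma shift_apply_eq:
  assumes "degree p \<le> n"
  shows "shift_apply p a k = (\<Sum>l\<le>n. coeff p l * a (k + l))"
  unfolding shift_apply_def using assms
  by (intro sum.mono_neutral_left) (auto simp: coeff_eq_0)

lemma shift_apply_0 [simp]: "shift_apply 0 a k = 0"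
  by (simp add: shift_apply_def)

lemma shift_apply_add: "shift_apply (p + q) a k = shift_apply p a k + shift_apply q a k"
  using shift_apply_eq[of "p + q" "max (degree p) (degree q)" a k]
    shift_apply_eq[of p "max (degree p) (degree q)" a k]
    shift_apply_eq[of q "max (degree p) (degree q)" a k]
  by (simp add: degree_add_le algebra_simps sum.distrib)

lemma shift_apply_smult: "shift_apply (smult c p) a k = c * shift_apply p a k"
  using shift_apply_eq[of "smult c p" "degree p" a k]
  by (simp add: degree_smult_le shift_apply_def sum_distrib_left mult.assoc)

lemma shift_apply_diff: "shift_apply (p - q) a k = shift_apply p a k - shift_apply q a k"
  using shift_apply_add[of p "smult (-1) q" a k] by (simp only: shift_apply_smult) simp

lemma shift_apply_sum: "shift_apply (\<Sum>i\<in>A. p i) a k = (\<Sum>i\<in>A. shift_apply (p i) a k)"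
  by (induction A rule: infinite_finite_induct) (simp_all add: shift_apply_add)

lemma shift_apply_monom: "shift_apply (monom c n) a k = c * a (k + n)"
  using shift_apply_eq[of "monom c n" n a k]
  by (simp add: degree_monom_le if_distrib[of "\<lambda>t. t * _"] cong: if_cong)

lemma shift_apply_pCons: "shift_apply (pCons c p) a k = c * a k + shift_apply p a (Suc k)"
  unfolding shift_apply_eq[OF degree_pCons_le] sum.atMost_Suc_shift shift_apply_def[of p] by simp

text \<open>The module law; with commutativity of \<open>*\<close> it lets factors be applied in any
  order.\<close>

lemma shift_apply_mult: "shift_apply (p * q) a k = shift_apply p (shift_apply q a) k"
  by (induction p arbitrary: k) (simp_all add: shift_apply_add shift_apply_smult shift_apply_pCons)

text \<open>In the expanded product, \<open>I\<close> collects the factors that contribute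
  \<open>- x i\<close>; the others contribute the variable.\<close>

lemma prod_linear_factors_expand:
  fixes x :: "'i \<Rightarrow> 'a::comm_ring_1"
  assumes "finite J"
  shows "(\<Prod>i\<in>J. [:- x i, 1:]) =
    (\<Sum>I\<in>Pow J. monom ((-1) ^ card I * (\<Prod>i\<in>I. x i)) (card J - card I))"
proof -
  have const: "(\<Prod>i\<in>I. [:- x i:]) = [:(-1) ^ card I * (\<Prod>i\<in>I. x i):]" if "finite I" for I
    using that by (induction I rule: finite_induct) (simp_all add: mult_ac)
  have "(\<Prod>i\<in>J. [:- x i, 1:]) = (\<Prod>i\<in>J. [:- x i:] + [:0, 1:])" by simp
  also have "\<dots> = (\<Sum>I\<in>Pow J. (\<Prod>i\<in>I. [:- x i:]) * (\<Prod>i\<in>J - I. [:0, 1:]))"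
    using assms by (rule prod_add)
  also have "\<dots> = (\<Sum>I\<in>Pow J. monom ((-1) ^ card I * (\<Prod>i\<in>I. x i)) (card J - card I))"
  proof (rule sum.cong)
    fix I assume "I \<in> Pow J"
    then have "finite I" "card (J - I) = card J - card I"
      using assms by (auto intro: finite_subset card_Diff_subset)
    then show "(\<Prod>i\<in>I. [:- x i:]) * (\<Prod>i\<in>J - I. [:0, 1:]) =
        monom ((-1) ^ card I * (\<Prod>i\<in>I. x i)) (card J - card I)"
      using const by (simp add: monom_altdef)
  qed simp
  finally show ?thesis .
qed

lemma shift_apply_prod_linear_factors:
  assumes "finite J"
  shows "shift_apply (\<Prod>i\<in>J. [:- x i, 1:]) a k =
    (\<Sum>I\<in>Pow J. (-1) ^ card I * (\<Prod>i\<in>I. x i) * a (k + card J - card I))"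
  unfolding prod_linear_factors_expand[OF assms] shift_apply_sum shift_apply_monom
  using assms by (intro sum.cong) (simp_all add: card_mono)

lemma shift_apply_recursion_poly:
  "shift_apply (recursion_poly d c) a k = a (k + d) - (\<Sum>j = 1..d. c j * a (k + d - j))"
proof -
  have "(\<Sum>j = 1..d. c j * a (k + (d - j))) = (\<Sum>j = 1..d. c j * a (k + d - j))"
    by (intro sum.cong) auto
  then show ?thesis
    by (simp add: recursion_poly_def shift_apply_diff shift_apply_sum shift_apply_monom)
qed

text \<open>Writing indices \<open>\<ge> d\<close> as \<open>k + d\<close> turns a recursion into
  annihilation by its characteristic polynomial.\<close>

lemma linear_recursion_iff:
  "linear_recursion a d c \<longleftrightarrow>
     d \<ge> 1 \<and> c d \<noteq> 0 \<and> (\<forall>k. shift_apply (recursion_poly d c) a k = 0)"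
proof -
  have "(\<forall>k\<ge>d. a k = (\<Sum>j = 1..d. c j * a (k - j))) \<longleftrightarrow>
      (\<forall>k. a (k + d) = (\<Sum>j = 1..d. c j * a (k + d - j)))"
    by (metis le_add2 le_add_diff_inverse2)
  then show ?thesis
    by (simp add: linear_recursion_def shift_apply_recursion_poly)
qed

text \<open>At a new root the factors already split off are nonzero by injectivity, so the cofactor
  vanishes there.\<close>

lemma prod_linear_factors_dvd:
  fixes x :: "'i \<Rightarrow> 'a::field"
  assumes "finite J" "inj_on x J" "\<And>i. i \<in> J \<Longrightarrow> poly p (x i) = 0"
  shows "(\<Prod>i\<in>J. [:- x i, 1:]) dvd p"
  using assms
proof (induction J rule: finite_induct)
  case (insert i J)
  then obtain q where q: "p = (\<Prod>i\<in>J. [:- x i, 1:]) * q" by (auto elim: dvdE)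
  have "poly (\<Prod>j\<in>J. [:- x j, 1:]) (x i) \<noteq> 0"
    using insert.hyps insert.prems(1) by (auto simp: poly_prod)
  then have "poly q (x i) = 0"
    using insert.prems(2)[of i] q by simp
  then have "[:- x i, 1:] dvd q" by (simp add: poly_eq_0_iff_dvd)
  then show ?case using insert.hyps q by (simp add: mult_dvd_mono mult.commute[of _ q] del: mult_pCons_left)
qed simp

text \<open>The components of a C-finite sequence along the simple roots \<open>x i\<close> are isolated by the
  operators that omit one linear factor.\<close>

lemma minimal_recursion_dvd:
  fixes x :: "'i \<Rightarrow> 'a::field"
  assumes "finite J" "inj_on x J"
    and annih: "\<And>k. shift_apply (\<Prod>i\<in>J. [:- x i, 1:]) a k = 0"
    and nz: "\<And>i. i \<in> J \<Longrightarrow> shift_apply (\<Prod>j\<in>J - {i}. [:- x j, 1:]) a 0 \<noteq> 0"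
    and p: "\<And>k. shift_apply p a k = 0"
  shows "(\<Prod>i\<in>J. [:- x i, 1:]) dvd p"
proof (rule prod_linear_factors_dvd[OF assms(1,2)])
  fix i assume i: "i \<in> J"
  define g where "g = (\<Prod>j\<in>J - {i}. [:- x j, 1:])"
  \<comment> \<open>The remaining factor with root \<open>x i\<close> annihilates \<open>b\<close>,
    which is therefore geometric with ratio \<open>x i\<close>.\<close>
  define b where "b = shift_apply g a"
  have "(\<Prod>i\<in>J. [:- x i, 1:]) = [:- x i, 1:] * g"
    unfolding g_def using assms(1) i by (rule prod.remove)
  then have "shift_apply [:- x i, 1:] b k = 0" for k
    using annih[of k] by (simp only: b_def shift_apply_mult)
  then have step: "b (Suc k) = x i * b k" for k
    by (simp add: shift_apply_pCons)
  have geometric: "b k = x i ^ k * b 0" for k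
    by (induction k) (simp_all add: step)
  \<comment> \<open>The operators commute, so \<open>p\<close> annihilates \<open>b\<close> too; on
    a geometric sequence it acts as multiplication by \<open>poly p (x i)\<close>.\<close>
  have "shift_apply p b 0 = shift_apply g (shift_apply p a) 0"
    unfolding b_def shift_apply_mult[symmetric] by (simp add: mult.commute)
  also have "\<dots> = 0" using p by (simp add: shift_apply_def[of g])
  finally have "poly p (x i) * b 0 = 0"
    by (simp add: shift_apply_def geometric[symmetric] poly_altdef sum_distrib_right mult.assoc)
  then show "poly p (x i) = 0" using nz[OF i] by (simp add: b_def g_def)
qed

section \<open>Laurent monomials\<close>

lemma Fract_sum: "Fract (\<Sum>i\<in>A. f i) 1 = (\<Sum>i\<in>A. Fract (f i) (1 :: 'a::idom))"
proof -
  have "Fract (p + q) 1 = Fract p 1 + Fract q (1 :: 'a)" for p q by simp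
  then show ?thesis
    by (induction A rule: infinite_finite_induct) (simp_all add: Zero_fract_def del: add_fract)
qed

lemma Fract_prod: "Fract (\<Prod>i\<in>A. f i) 1 = (\<Prod>i\<in>A. Fract (f i) (1 :: 'a::idom))"
proof -
  have "Fract (p * q) 1 = Fract p 1 * Fract q (1 :: 'a)" for p q by simp
  then show ?thesis
    by (induction A rule: infinite_finite_induct) (simp_all add: One_fract_def del: mult_fract)
qed

lemma Fract_of_int: "Fract (of_int z) (1 :: 'a::idom) = of_int z"
  by (cases z rule: int_cases2) (simp_all add: Fract_of_nat_eq flip: minus_fract)

lemma indet_nonzero [simp]: "indet i \<noteq> 0"
proof -
  have "Poly_Mapping.single e 1 \<noteq> (0 :: 'a mpoly)" for e
    by (metis lookup_single_eq lookup_zero zero_neq_one)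
  then show ?thesis by (simp add: indet_def Zero_fract_def eq_fract)
qed

lemma indet_power:
  "indet i ^ n = Fract (Poly_Mapping.single (Poly_Mapping.single (Var i) n) 1) 1"
  by (induction n)
    (simp_all add: indet_def One_fract_def mult_single single_add[symmetric] flip: single_one)

lemma xpow_nonzero [simp]: "xpow m \<noteq> 0"
  by (simp add: xpow_def)

lemma xpow_0 [simp]: "xpow 0 = 1"
  by (simp add: xpow_def)

lemma xpow_add: "xpow (l + m) = xpow l * xpow m"
  by (simp add: xpow_def power_int_add prod.distrib)

lemma xpow_sum: "xpow (\<Sum>i\<in>A. f i) = (\<Prod>i\<in>A. xpow (f i))"
  by (induction A rule: infinite_finite_induct) (simp_all add: xpow_add)

text \<open>Faithful only for nonnegative \<open>m\<close>, since \<open>nat\<close> cuts negative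
  entries to 0.\<close>

definition monomial_exponent :: "int ^ 'n \<Rightarrow> ('n::finite var \<Rightarrow>\<^sub>0 nat)" where
  "monomial_exponent m = (\<Sum>i\<in>UNIV. Poly_Mapping.single (Var i) (nat (m $ i)))"

lemma lookup_monomial_exponent: "Poly_Mapping.lookup (monomial_exponent m) (Var i) = nat (m $ i)"
  by (simp add: monomial_exponent_def lookup_sum lookup_single when_def)

lemma xpow_nonneg:
  assumes "\<And>i. 0 \<le> m $ i"
  shows "xpow m = Fract (Poly_Mapping.single (monomial_exponent m) 1) 1"
proof -
  have single: "(\<Prod>i\<in>A. Poly_Mapping.single (e i) 1) =
      (Poly_Mapping.single (\<Sum>i\<in>A. e i) 1 :: 'n mpoly)" for A and e :: "'n \<Rightarrow> ('n var \<Rightarrow>\<^sub>0 nat)"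
    by (induction A rule: infinite_finite_induct) (simp_all add: mult_single)
  have "xpow m = (\<Prod>i\<in>UNIV. indet i ^ nat (m $ i))"
    using assms by (simp add: xpow_def power_int_def)
  also have "\<dots> = Fract (\<Prod>i\<in>UNIV. Poly_Mapping.single (Poly_Mapping.single (Var i) (nat (m $ i))) 1) 1"
    by (simp add: indet_power Fract_prod)
  finally show ?thesis by (simp add: single monomial_exponent_def)
qed

text \<open>Multiplication by a suitable monomial clears all negative exponents; then coefficients
  of polynomials can be compared.\<close>

lemma xpow_independent:
  assumes "finite M" "(\<Sum>m\<in>M. of_int (f m) * xpow m) = 0" "l \<in> M"
  shows "f l = 0"
proof -
  \<comment> \<open>Large enough to make \<open>m + s\<close> nonnegative for every
    \<open>m \<in> M\<close>.\<close>
  define s :: "int ^ 'a" where "s = (\<chi> i. \<Sum>m\<in>M. \<bar>m $ i\<bar>)"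
  have nonneg: "0 \<le> (m + s) $ i" if "m \<in> M" for m i
    using member_le_sum[of m M "\<lambda>m. \<bar>m $ i\<bar>"] that assms(1) by (simp add: s_def)
  let ?X = "\<lambda>m. Poly_Mapping.single (monomial_exponent (m + s)) (of_int (f m)) :: 'a mpoly"
  have of_int_single: "of_int z * Poly_Mapping.single e 1 = (Poly_Mapping.single e (of_int z) :: 'a mpoly)"
    for z e
    by (metis add_0 mult.right_neutral mult_single single_of_int)
  have "Fract (\<Sum>m\<in>M. ?X m) 1 = (\<Sum>m\<in>M. of_int (f m) * xpow (m + s))"
    unfolding Fract_sum
  proof (rule sum.cong)
    fix m assume "m \<in> M"
    then have "xpow (m + s) = Fract (Poly_Mapping.single (monomial_exponent (m + s)) 1) 1"
      by (intro xpow_nonneg nonneg)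
    then show "Fract (?X m) 1 = of_int (f m) * xpow (m + s)"
      by (simp add: of_int_single flip: Fract_of_int)
  qed simp
  also have "\<dots> = (\<Sum>m\<in>M. of_int (f m) * xpow m) * xpow s"
    by (simp add: xpow_add sum_distrib_right mult.assoc)
  finally have "Fract (\<Sum>m\<in>M. ?X m) 1 = Fract 0 1"
    using assms(2) by (simp flip: Zero_fract_def)
  then have "(\<Sum>m\<in>M. ?X m) = 0" by (simp add: eq_fract)
  then have "0 = (\<Sum>m\<in>M. Poly_Mapping.lookup (?X m) (monomial_exponent (l + s)))"
    by (simp flip: lookup_sum)
  also have "\<dots> = (\<Sum>m\<in>M. if m = l then of_int (f l) else 0)"
  proof (rule sum.cong)
    fix m assume m: "m \<in> M"
    \<comment> \<open>Nonnegativity ensures that \<open>nat\<close> loses nothing here, so distinct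
      \<open>m\<close> give distinct monomials.\<close>
    have "m = l" if "monomial_exponent (m + s) = monomial_exponent (l + s)"
    proof (rule vec_eq_iff[THEN iffD2], rule allI)
      fix i
      have "nat ((m + s) $ i) = nat ((l + s) $ i)"
        using that by (metis lookup_monomial_exponent)
      then show "m $ i = l $ i"
        using nonneg[OF m, of i] nonneg[OF assms(3), of i] by simp
    qed
    then show "Poly_Mapping.lookup (?X m) (monomial_exponent (l + s)) = (if m = l then of_int (f l) else 0)"
      by (auto simp: lookup_single when_def)
  qed simp
  also have "\<dots> = of_int (f l)" using assms(1,3) by simp
  finally show ?thesis by (metis of_int_0 of_int_eq_iff)
qed

text \<open>A coincidence of two monomials would be a relation with coefficients 1 and -1.\<close>

lemma inj_xpow: "inj xpow"
proof (rule injI)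
  fix l m :: "int ^ 'a"
  assume eq: "xpow l = xpow m"
  show "l = m"
  proof (rule ccontr)
    assume "l \<noteq> m"
    then have "(\<Sum>j\<in>{l, m}. of_int (if j = l then 1 else -1) * xpow j) = 0"
      using eq by simp
    from xpow_independent[OF _ this, of l] show False by simp
  qed
qed

section \<open>Integer point transforms\<close>

lemma real_vec_simps [simp]:
  "real_vec 0 = 0" "real_vec (l + m) = real_vec l + real_vec m"
  "real_vec (l - m) = real_vec l - real_vec m"
  by (simp_all add: real_vec_def vec_eq_iff)

lemma real_vec_sum [simp]: "real_vec (\<Sum>i\<in>A. f i) = (\<Sum>i\<in>A. real_vec (f i))"
  by (induction A rule: infinite_finite_induct) simp_all

lemma real_vec_eq_iff [simp]: "real_vec l = real_vec m \<longleftrightarrow> l = m"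
  by (simp add: real_vec_def vec_eq_iff)

text \<open>The norm bounds every coordinate, so the points lie in a finite integer box.\<close>

lemma finite_lattice_points:
  fixes S :: "(real ^ 'n::finite) set"
  assumes "bounded S"
  shows "finite {m. real_vec m \<in> S}"
proof -
  obtain b where b: "\<And>x. x \<in> S \<Longrightarrow> norm x \<le> b" using assms by (auto simp: bounded_iff)
  have "{m. real_vec m \<in> S} \<subseteq> (\<lambda>f. \<chi> i. f i) ` (UNIV \<rightarrow>\<^sub>E {\<lfloor>- b\<rfloor>..\<lceil>b\<rceil>})"
  proof clarify
    fix m :: "int ^ 'n" assume m: "real_vec m \<in> S"
    have "\<bar>real_of_int (m $ i)\<bar> \<le> b" for i
      using component_le_norm_cart[of "real_vec m" i] b[OF m] by (simp add: real_vec_def)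
    then have "m $ i \<in> {\<lfloor>- b\<rfloor>..\<lceil>b\<rceil>}" for i
      unfolding abs_le_iff atLeastAtMost_iff by (smt (verit) floor_le_iff le_ceiling_iff)
    then show "m \<in> (\<lambda>f. \<chi> i. f i) ` (UNIV \<rightarrow>\<^sub>E {\<lfloor>- b\<rfloor>..\<lceil>b\<rceil>})"
      by (intro image_eqI[of _ _ "\<lambda>i. m $ i"]) auto
  qed
  then show ?thesis by (rule finite_subset) (intro finite_imageI finite_PiE; simp)
qed

lemma xpow_mult_int_transform:
  "xpow w * int_transform S = (\<Sum>m | real_vec (m - w) \<in> S. xpow m)"
proof -
  have "xpow w * int_transform S = (\<Sum>m | real_vec m \<in> S. xpow (m + w))"
    by (simp add: int_transform_def sum_distrib_left xpow_add mult.commute)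
  also have "\<dots> = (\<Sum>m | real_vec (m - w) \<in> S. xpow m)"
    by (rule sum.reindex_bij_witness[of _ "\<lambda>m. m - w" "\<lambda>m. m + w"]) auto
  finally show ?thesis .
qed

text \<open>Exchanging the sums exhibits an integer coefficient at each \<open>xpow m\<close>, and
  independence of monomials separates these coefficients.\<close>

lemma combination_int_transform_eq_0_iff:
  fixes S :: "'i \<Rightarrow> (real ^ 'n::finite) set"
  assumes "finite F" "\<And>I. I \<in> F \<Longrightarrow> bounded (S I)"
  shows "(\<Sum>I\<in>F. of_int (e I) * (xpow (w I) * int_transform (S I))) = 0 \<longleftrightarrow>
    (\<forall>m. (\<Sum>I | I \<in> F \<and> real_vec (m - w I) \<in> S I. e I) = 0)" (is "?L = 0 \<longleftrightarrow> (\<forall>m. ?c m = 0)")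
proof -
  define M where "M = (\<Union>I\<in>F. {m. real_vec (m - w I) \<in> S I})"
  have fin: "finite {m. real_vec (m - w I) \<in> S I}" if "I \<in> F" for I
  proof -
    have "{m. real_vec (m - w I) \<in> S I} = (\<lambda>m. m + w I) ` {m. real_vec m \<in> S I}"
      by (auto intro!: image_eqI[of _ _ "_ - w I"])
    then show ?thesis using finite_lattice_points[OF assms(2)[OF that]] by simp
  qed
  then have "finite M" using assms(1) by (simp add: M_def)
  have "?L = (\<Sum>I\<in>F. \<Sum>m\<in>M. if real_vec (m - w I) \<in> S I then of_int (e I) * xpow m else 0)"
  proof (rule sum.cong)
    fix I assume "I \<in> F"
    then have "{m. real_vec (m - w I) \<in> S I} = M \<inter> {m. real_vec (m - w I) \<in> S I}"
      by (auto simp: M_def)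
    then show "of_int (e I) * (xpow (w I) * int_transform (S I)) =
        (\<Sum>m\<in>M. if real_vec (m - w I) \<in> S I then of_int (e I) * xpow m else 0)"
      using \<open>finite M\<close> sum.inter_restrict[of M "\<lambda>m. of_int (e I) * xpow m" "{m. real_vec (m - w I) \<in> S I}"]
      by (simp add: xpow_mult_int_transform sum_distrib_left)
  qed simp
  also have "\<dots> = (\<Sum>m\<in>M. \<Sum>I\<in>F. if real_vec (m - w I) \<in> S I then of_int (e I) * xpow m else 0)"
    by (rule sum.swap)
  also have "\<dots> = (\<Sum>m\<in>M. of_int (?c m) * xpow m)"
    using assms(1) by (simp only: sum.inter_filter[symmetric] of_int_sum sum_distrib_right)
  finally have L: "?L = (\<Sum>m\<in>M. of_int (?c m) * xpow m)" .
  show ?thesis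
  proof
    assume "?L = 0"
    then have "?c m = 0" if "m \<in> M" for m
      using xpow_independent[OF \<open>finite M\<close> _ that, of ?c] L by simp
    moreover have "?c m = 0" if "m \<notin> M" for m
      using that by (intro sum.neutral) (auto simp: M_def)
    ultimately show "\<forall>m. ?c m = 0" by blast
  qed (simp add: L)
qed

section \<open>Vertex operators and their coefficients\<close>

lemma int_transform_vertex_operator_eq_0_iff:
  fixes v :: "'i \<Rightarrow> int ^ 'n::finite"
  assumes "finite J" "bounded P" "bounded Q"
  shows "shift_apply (\<Prod>i\<in>J. [:- xpow (v i), 1:]) (\<lambda>k. int_transform (dilate k P + Q)) k = 0 \<longleftrightarrow>
    (\<forall>m. (\<Sum>I | I \<subseteq> J \<and> real_vec m - (\<Sum>i\<in>I. real_vec (v i)) \<in> dilate (k + card J - card I) P + Q.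
      (-1) ^ card I) = (0::int))"
proof -
  have "bounded (dilate s P + Q)" for s
  proof -
    have "dilate s P + Q = (\<lambda>(x, y). x + y) ` (dilate s P \<times> Q)"
      by (auto simp: set_plus_def)
    then show ?thesis
      using assms(2,3) by (simp add: bounded_plus bounded_scaling dilate_def)
  qed
  then show ?thesis
    using combination_int_transform_eq_0_iff[of "Pow J" "\<lambda>I. dilate (k + card J - card I) P + Q"
        "\<lambda>I. (-1) ^ card I" "\<lambda>I. \<Sum>i\<in>I. v i"] assms(1)
    by (simp add: shift_apply_prod_linear_factors xpow_sum mult.assoc)
qed

text \<open>Subsets in the expanded product are grouped by size. The empty set gives the leading
  term; the extra sign in \<open>vertex_coeff\<close> cancels the minus in
  \<open>recursion_poly\<close>.\<close>

lemma recursion_poly_vertex_coeff: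
  "recursion_poly r (vertex_coeff r v) = (\<Prod>i\<in>{1..r}. [:- xpow (v i), 1:])"
proof -
  define T where "T I = monom ((-1) ^ card I * (\<Prod>i\<in>I. xpow (v i))) (r - card I)" for I
  have card: "card I \<in> {0..r}" if "I \<in> Pow {1..r}" for I
    using that card_mono[of "{1..r}" I] by simp
  have "(\<Prod>i\<in>{1..r}. [:- xpow (v i), 1:]) = (\<Sum>I\<in>Pow {1..r}. T I)"
    by (simp add: prod_linear_factors_expand T_def)
  also have "\<dots> = (\<Sum>j\<in>{0..r}. \<Sum>I | I \<in> Pow {1..r} \<and> card I = j. T I)"
    using card by (intro sum.group[symmetric]) auto
  also have "\<dots> = (\<Sum>I | I \<in> Pow {1..r} \<and> card I = 0. T I) +
      (\<Sum>j = 1..r. \<Sum>I | I \<in> Pow {1..r} \<and> card I = j. T I)"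
    by (simp add: sum.atLeast_Suc_atMost)
  also have "{I. I \<in> Pow {1..r} \<and> card I = 0} = {{}}"
    by (auto simp: card_eq_0_iff dest: finite_subset)
  also have "(\<Sum>j = 1..r. \<Sum>I | I \<in> Pow {1..r} \<and> card I = j. T I) =
      (\<Sum>j = 1..r. - monom (vertex_coeff r v j) (r - j))"
  proof (rule sum.cong)
    fix j
    have "(\<Sum>I | I \<in> Pow {1..r} \<and> card I = j. T I) =
        (\<Sum>I | I \<subseteq> {1..r} \<and> card I = j. monom ((-1) ^ card I * xpow (\<Sum>i\<in>I. v i)) (r - j))"
      by (intro sum.cong) (auto simp: T_def xpow_sum)
    also have "\<dots> = - monom (vertex_coeff r v j) (r - j)"
      by (simp add: vertex_coeff_def sum_negf monom_sum flip: minus_monom)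
    finally show "(\<Sum>I | I \<in> Pow {1..r} \<and> card I = j. T I) = - monom (vertex_coeff r v j) (r - j)" .
  qed simp
  finally show ?thesis by (simp add: recursion_poly_def T_def sum_negf)
qed

text \<open>Provides the nonvanishing hypothesis of \<open>minimal_recursion_dvd\<close>: one
  coefficient of the result equals 1.\<close>

lemma vertex_operator_nonzero:
  fixes v :: "'i \<Rightarrow> int ^ 'n::finite"
  assumes "polytope P" "lattice_polytope Q" "Q \<noteq> {}" "finite A" "i \<in> A"
    and v: "inj_on (\<lambda>i. real_vec (v i)) A" "(\<lambda>i. real_vec (v i)) ` A = vertices P"
  shows "shift_apply (\<Prod>j\<in>A - {i}. [:- xpow (v j), 1:]) (\<lambda>k. int_transform (dilate k P + Q)) 0 \<noteq> 0"
proof -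
  define V where "V = (\<lambda>i. real_vec (v i))"
  have polyQ: "polytope Q" and latQ: "vertices Q \<subseteq> range real_vec"
    using assms(2) by (auto simp: lattice_polytope_def)
  have V: "V j extreme_point_of P" if "j \<in> A" for j
    using that v(2) by (auto simp: V_def vertices_def)
  then have VP: "V j \<in> P" if "j \<in> A" for j
    using that by (auto simp: extreme_point_of_def)
  \<comment> \<open>Vertices of polytopes are exposed; this yields the functional \<open>c\<close>,
    whose maximum \<open>b\<close> on \<open>P\<close> is attained only at
    \<open>V i\<close>.\<close>
  have "{V i} exposed_face_of P"
    using exposed_face_of_polyhedron[OF polytope_imp_polyhedron[OF assms(1)]] V[OF assms(5)]
    by (simp add: face_of_singleton)
  then obtain c b where cb: "P \<subseteq> {x. c \<bullet> x \<le> b}" "{V i} = P \<inter> {x. c \<bullet> x = b}"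
    by (auto simp: exposed_face_of_def)
  then have ci: "c \<bullet> V i = b" by auto
  have cj: "c \<bullet> V j < b" if "j \<in> A - {i}" for j
  proof -
    have "V j \<noteq> V i" using that assms(5) inj_onD[OF v(1), of j i] by (auto simp: V_def)
    then have "c \<bullet> V j \<noteq> b" using cb(2) VP that by auto
    then show ?thesis using cb(1) VP that by fastforce
  qed
  have "continuous_on Q (\<lambda>x. c \<bullet> x)" by (intro continuous_intros)
  then obtain q where q: "q \<in> Q" "\<And>x. x \<in> Q \<Longrightarrow> c \<bullet> x \<le> c \<bullet> q"
    using continuous_attains_sup[of Q] polytope_imp_compact[OF polyQ] assms(3) by metis
  \<comment> \<open>The face of \<open>Q\<close> where \<open>c\<close> is maximal: its extreme
    points are vertices of \<open>Q\<close>, hence integral.\<close>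
  define G where "G = Q \<inter> {x. c \<bullet> x = c \<bullet> q}"
  have face: "G face_of Q"
    unfolding G_def by (rule face_of_Int_supporting_hyperplane_le) (use q polyQ polytope_imp_convex in auto)
  have "compact G" "convex G" "G \<noteq> {}"
    using face polyQ polytope_imp_compact polytope_imp_convex q
    by (auto simp: G_def intro: face_of_imp_compact face_of_imp_convex
        compact_Int_closed closed_hyperplane convex_Int convex_hyperplane)
  then obtain w where w: "w extreme_point_of G"
    using extreme_point_exists_convex by blast
  then have "w \<in> vertices Q" "w \<in> G"
    using face by (auto simp: extreme_point_of_face vertices_def)
  then obtain w' where w': "w = real_vec w'" "w \<in> Q" "c \<bullet> w = c \<bullet> q"
    using latQ by (auto simp: G_def)
  define m where "m = (\<Sum>j\<in>A - {i}. v i) + w'"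
  have m: "real_vec m = real (card (A - {i})) *\<^sub>R V i + w"
    by (simp add: m_def w' V_def sum_constant_scaleR del: sum_constant)
  have "I = {}" if I: "I \<subseteq> A - {i}"
    and mem: "real_vec m - (\<Sum>j\<in>I. V j) \<in> dilate (card (A - {i}) - card I) P + Q" for I
  proof (rule ccontr)
    assume "I \<noteq> {}"
    have fin: "finite I" "card I \<le> card (A - {i})"
      using I assms(4) by (auto intro: finite_subset card_mono)
    obtain p y where p: "p \<in> P" and y: "y \<in> Q"
      and eq: "real_vec m - (\<Sum>j\<in>I. V j) = real (card (A - {i}) - card I) *\<^sub>R p + y"
      using mem by (auto simp: dilate_def set_plus_def)
    \<comment> \<open>For nonempty \<open>I\<close> the left side is in fact larger, since each
      \<open>V j\<close> with \<open>j \<in> I\<close> has \<open>c\<close>-value below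
      \<open>b\<close>.\<close>
    have "c \<bullet> (real_vec m - (\<Sum>j\<in>I. V j)) \<le> real (card (A - {i}) - card I) * b + c \<bullet> q"
      unfolding eq inner_add_right inner_scaleR_right
      using cb(1) p q(2)[OF y] by (intro add_mono mult_left_mono) auto
    also have "c \<bullet> (real_vec m - (\<Sum>j\<in>I. V j)) =
        real (card (A - {i})) * b + c \<bullet> q - (\<Sum>j\<in>I. c \<bullet> V j)"
      by (simp add: m inner_diff_right inner_add_right inner_sum_right ci w'(3))
    finally have "real (card I) * b \<le> (\<Sum>j\<in>I. c \<bullet> V j)"
      using fin by (simp add: of_nat_diff algebra_simps)
    moreover have "(\<Sum>j\<in>I. c \<bullet> V j) < (\<Sum>j\<in>I. b)"
      using fin \<open>I \<noteq> {}\<close> I cj by (intro sum_strict_mono) auto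
    ultimately show False by simp
  qed
  moreover have "real_vec m \<in> dilate (card (A - {i})) P + Q"
    unfolding m using VP[OF assms(5)] w'(2) by (auto simp: dilate_def intro!: set_plus_intro)
  ultimately have "{I. I \<subseteq> A - {i} \<and>
      real_vec m - (\<Sum>j\<in>I. V j) \<in> dilate (0 + card (A - {i}) - card I) P + Q} = {{}}"
    by auto
  then have coeff: "(\<Sum>I | I \<subseteq> A - {i} \<and> real_vec m - (\<Sum>j\<in>I. real_vec (v j)) \<in>
      dilate (0 + card (A - {i}) - card I) P + Q. (-1) ^ card I) = (1::int)"
    by (simp add: V_def)
  have "finite (A - {i})" "bounded P" "bounded Q"
    using assms polyQ polytope_imp_bounded by auto
  note iff = int_transform_vertex_operator_eq_0_iff[OF this, of v 0]
  show ?thesis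
  proof
    assume "shift_apply (\<Prod>j\<in>A - {i}. [:- xpow (v j), 1:])
      (\<lambda>k. int_transform (dilate k P + Q)) 0 = 0"
    from iff[THEN iffD1, OF this, rule_format, of m] coeff show False by linarith
  qed
qed

section \<open>The recursion and its minimality\<close>

theorem theorem1p1:
  fixes P Q :: "(real ^ 'n) set" and v :: "nat \<Rightarrow> int ^ 'n" and r :: nat
  assumes "polytope Q"
    and "lattice_polytope P" and "P \<noteq> {}"
    and "bij_betw (\<lambda>i. real_vec (v i)) {1..r} (vertices P)"
  shows "(\<forall>k. int_transform (dilate (k + r) P + Q) =
            (\<Sum>I | I \<noteq> {} \<and> I \<subseteq> {1..r}. (-1) ^ (1 + card I) * xpow (\<Sum>i\<in>I. v i) *
               int_transform (dilate (k + r - card I) P + Q))) \<and>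
         linear_recursion (\<lambda>k. int_transform (dilate k P + Q)) r (vertex_coeff r v) \<and>
         recursion_poly r (vertex_coeff r v) = vertex_poly P \<and>
         (lattice_polytope Q \<and> Q \<noteq> {} \<longrightarrow>
            minimal_for (\<lambda>k. int_transform (dilate k P + Q)) (vertex_poly P))"
proof -
  define a where "a = (\<lambda>k. int_transform (dilate k P + Q))"
  define p where "p = (\<Prod>i\<in>{1..r}. [:- xpow (v i), 1:])"
  have polyP: "polytope P"
    using assms(2) by (simp add: lattice_polytope_def)
  have inj: "inj_on (\<lambda>i. real_vec (v i)) {1..r}" and im: "(\<lambda>i. real_vec (v i)) ` {1..r} = vertices P"
    using assms(4) by (auto simp: bij_betw_def)
  have inj_v: "inj_on v {1..r}" using inj by (rule inj_on_imageI2[of real_vec, unfolded comp_def])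
  have hull: "P = convex hull ((\<lambda>i. real_vec (v i)) ` {1..r})"
    unfolding im vertices_def
    by (rule Krein_Milman_Minkowski[OF polytope_imp_compact[OF polyP] polytope_imp_convex[OF polyP]])
  have r: "r \<ge> 1"
  proof (rule ccontr)
    assume "\<not> r \<ge> 1"
    then have "P = {}" using hull by simp
    then show False using assms(3) by simp
  qed
  have annih: "shift_apply p a k = 0" for k
  proof -
    have "(\<Sum>I | I \<subseteq> {1..r} \<and> real_vec m - (\<Sum>i\<in>I. real_vec (v i)) \<in>
        dilate (k + card {1..r} - card I) P + Q. (-1) ^ card I) = (0::int)" for m
      using r by (intro alternating_sum_dilates[OF _ _ inj polytope_imp_compact[OF assms(1)]
            polytope_imp_convex[OF assms(1)], folded hull]) auto
    then show ?thesis
      unfolding a_def p_def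
      using polytope_imp_bounded[OF polyP] polytope_imp_bounded[OF assms(1)]
      by (subst int_transform_vertex_operator_eq_0_iff) auto
  qed
  have "a (k + r) = (\<Sum>I | I \<noteq> {} \<and> I \<subseteq> {1..r}. (-1) ^ (1 + card I) * xpow (\<Sum>i\<in>I. v i) *
      a (k + r - card I))" for k
  proof -
    \<comment> \<open>The term of \<open>I = {}\<close> is \<open>a (k + r)\<close>; solving for it
      flips the signs of the others.\<close>
    have "0 = (\<Sum>I\<in>Pow {1..r}. (-1) ^ card I * (\<Prod>i\<in>I. xpow (v i)) * a (k + r - card I))"
      using annih[of k] unfolding p_def by (subst (asm) shift_apply_prod_linear_factors) simp_all
    also have "\<dots> = a (k + r) +
        (\<Sum>I\<in>Pow {1..r} - {{}}. (-1) ^ card I * (\<Prod>i\<in>I. xpow (v i)) * a (k + r - card I))"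
      by (subst sum.remove[of _ "{}"]) auto
    also have "Pow {1..r} - {{}} = {I. I \<noteq> {} \<and> I \<subseteq> {1..r}}" by auto
    finally show ?thesis
      by (simp add: xpow_sum sum_negf eq_neg_iff_add_eq_0)
  qed
  moreover have char: "recursion_poly r (vertex_coeff r v) = p"
    by (simp add: recursion_poly_vertex_coeff p_def)
  have rec: "linear_recursion a r (vertex_coeff r v)"
  proof -
    \<comment> \<open>Only the full index set has size \<open>r\<close>, so the last coefficient is
      a signed monomial, hence nonzero.\<close>
    have "{I. I \<subseteq> {1..r} \<and> card I = r} = {{1..r}}"
      using card_subset_eq[of "{1..r}"] by auto
    then show ?thesis
      using r annih by (simp add: linear_recursion_iff char vertex_coeff_def)
  qed
  moreover have "p = vertex_poly P"
  proof -
    have "{w. real_vec w \<in> vertices P} = v ` {1..r}"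
      unfolding im[symmetric] by auto
    then show ?thesis
      using inj_v by (simp add: vertex_poly_def p_def prod.reindex)
  qed
  moreover have "minimal_for a p" if Q: "lattice_polytope Q" "Q \<noteq> {}"
    unfolding minimal_for_def
  proof (intro conjI allI impI)
    show "\<exists>d c. linear_recursion a d c \<and> p = recursion_poly d c"
      using rec char by metis
    fix d c assume "linear_recursion a d c"
    then have "shift_apply (recursion_poly d c) a k = 0" for k
      by (simp add: linear_recursion_iff)
    moreover have "shift_apply (\<Prod>j\<in>{1..r} - {i}. [:- xpow (v j), 1:]) a 0 \<noteq> 0" if "i \<in> {1..r}" for i
      unfolding a_def using vertex_operator_nonzero[OF polyP Q _ that inj im] by simp
    moreover have "inj_on (\<lambda>i. xpow (v i)) {1..r}"
      using comp_inj_on[OF inj_v inj_on_subset[OF inj_xpow subset_UNIV]] by (simp add: comp_def)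
    ultimately show "p dvd recursion_poly d c"
      using annih unfolding p_def by (intro minimal_recursion_dvd) auto
  qed
  ultimately show ?thesis using char by (simp add: a_def)
qed

end
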